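(* Let $f\ge 2$, $k$, $m>1$, $n>1$ be integers with $0\le k\le (m-1)n$, and let $\{A_0,A_1,\ldots,A_5\}$ be a symmetric association scheme with $5$ classes on a vertex set $X$ whose primitive idempotents can be ordered $E_0=\frac{1}{|X|}J,E_1,\ldots,E_5$ so that the first eigenmatrix $P=(P_{j,i})_{j,i=0}^5$ (defined by $A_i=\sum_{j}P_{j,i}E_j$) is $$P=\begin{pmatrix} 1 & n-1 & (m-1)n & (f-1)k & (f-1)(mn-k-n) & (f-1)n\\ 1 & -1 & 0 & (f-1)s & -(f-1)s & 0\\ 1 & n-1 & -n & -\frac{(f-1)k}{m-1} & \frac{(f-1)(k+n-mn)}{m-1} & (f-1)n\\ 1 & n-1 & -n & \frac{k}{m-1} & n-\frac{k}{m-1} & -n\\ 1 & -1 & 0 & -s & s & 0\\ 1 & n-1 & (m-1)n & -k & k+n-mn & -n \end{pmatrix},\qquad s=\frac{\sqrt{k(mn-k-n)}}{\sqrt{(m-1)(n-1)}}.$$ (So $f=m_5+1$, where $m_5$ is the rank of $E_5$.) Set $\lambda_1=\frac{1}{f-1}p_{3,3}^1$ and $\lambda_2=\frac{1}{f-1}p_{3,3}^4$, and assume $\lambda_1<k<(m-1)n$. (i) If $f=2$, then there exists a symmetric group divisible design $A_{1,2}$ with parameters $(mn,k,m,n,\lambda_1,\lambda_2)$ such that $A_{1,2}+K_{m,n}$ is a symmetric group divisible design. (ii) If $f\geq 3$, then there exists a linked system of symmetric group divisible designs of type II $A_{i,j}$ ($i,j\in\{1,\ldots,f\}$, $i\neq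 j$) with parameters $(mn,k,m,n,\lambda_1,\lambda_2)$.
   Context: $I_t$, $J_t$ denote the $t\times t$ identity and all-ones matrices (also $J$ for the all-ones matrix on $X$). A symmetric association scheme with $d$ classes on a finite set $X$ is a set of non-zero $(0,1)$-matrices $A_0,\ldots,A_d$ indexed by $X$ with $A_0=I$, $\sum_iA_i=J$, $A_i^\top=A_i$, and $A_iA_j=\sum_kp_{i,j}^kA_k$ for non-negative integers $p_{i,j}^k$ (intersection numbers); their span is a commutative algebra with a basis of primitive idempotents $E_0=\frac{1}{|X|}J,E_1,\ldots,E_d$. For integers $m,n\ge 2$ with $v=mn$, $K_{m,n}=I_m\otimes J_n$. A $v\times v$ $(0,1)$-matrix $A$ is a symmetric group divisible design with parameters $(v,k,m,n,\lambda_1,\lambda_2)$ if $AA^\top=A^\top A=kI_v+\lambda_1(K_{m,n}-I_v)+\lambda_2(J_v-K_{m,n})$. For $f\ge3$, a family $A_{i,j}$ ($i\neq j\in\{1,\ldots,f\}$) of such designs with common parameters is a linked system of symmetric group divisible designs of type II with these parameters if each $A_{i,j}+K_{m,n}$ is a $(0,1)$-matrix and there are non-negative integers $\sigma,\tau,\rho$ with $A_{i,j}A_{j,l}=\sigma A_{i,l}+\tau(J_v-A_{i,l}-K_{m,n})+\rho K_{m,n}$ for all mutually distinct $i,j,l$.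
   Formalization: The formal theorem sets λ_2 = p_{3,3}^2/(f-1) instead of p_{3,3}^4/(f-1); the printed index fails already for f=2, where p_{3,3}^4=0 (e.g. m=n=4, k=6, λ_1=2 would need 36=12). *)

theory Defs
  imports "HOL-Analysis.Analysis" "Jordan_Normal_Form.Matrix"
begin

text \<open>
  The vertex set \<open>X\<close> of a scheme is the finite type \<^typ>\<open>'x\<close>, so its matrices live in
  \<^typ>\<open>real^'x^'x\<close>.  Designs have \<open>m n\<close> points, where \<open>m\<close> and \<open>n\<close> are numbers; their matrices
  are therefore dimension-indexed ones, of type \<^typ>\<open>real mat\<close>.
\<close>

no_notation Matrix.vec_index (infixl "$" 100)
hide_const (open) Matrix.mat
hide_const (open) List.transpose

section \<open>Symmetric association schemes\<close>

definition all_ones :: "real^'x^'x" where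
  "all_ones = (\<chi> x y. 1)"

definition intersection_numbers ::
    "nat \<Rightarrow> (nat \<Rightarrow> real^'x^'x) \<Rightarrow> (nat \<Rightarrow> nat \<Rightarrow> nat \<Rightarrow> nat) \<Rightarrow> bool" where
  \<comment> \<open>\<open>p i j k\<close> is the number with lower indices \<open>i\<close>, \<open>j\<close> and upper index \<open>k\<close>.\<close>
  "intersection_numbers d A p \<longleftrightarrow>
     (\<forall>i\<le>d. \<forall>j\<le>d. A i ** A j = (\<Sum>k\<le>d. real (p i j k) *\<^sub>R A k))"

definition symmetric_association_scheme :: "nat \<Rightarrow> (nat \<Rightarrow> real^'x^'x) \<Rightarrow> bool" where
  "symmetric_association_scheme d A \<longleftrightarrow>
     (\<forall>i\<le>d. A i \<noteq> 0 \<and> (\<forall>x y. A i $ x $ y \<in> {0, 1})) \<and>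
     A 0 = mat 1 \<and>
     (\<Sum>i\<le>d. A i) = all_ones \<and>
     (\<forall>i\<le>d. transpose (A i) = A i) \<and>
     (\<exists>p. intersection_numbers d A p)"

definition adjacency_algebra :: "nat \<Rightarrow> (nat \<Rightarrow> real^'x^'x) \<Rightarrow> (real^'x^'x) set" where
  "adjacency_algebra d A = span (A ` {..d})"

text \<open>
  A non-zero idempotent is primitive if it is not the sum of two non-zero orthogonal idempotents
  of the algebra.
\<close>

definition primitive_idempotent :: "(real^'x^'x) set \<Rightarrow> real^'x^'x \<Rightarrow> bool" where
  "primitive_idempotent \<A> E \<longleftrightarrow>
     E \<in> \<A> \<and> E \<noteq> 0 \<and> E ** E = E \<and>
     \<not> (\<exists>F\<in>\<A>. \<exists>G\<in>\<A>. F \<noteq> 0 \<and> G \<noteq> 0 \<and> F ** F = F \<and> G ** G = G \<and>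
          F ** G = 0 \<and> G ** F = 0 \<and> E = F + G)"

definition primitive_idempotent_ordering ::
    "nat \<Rightarrow> (nat \<Rightarrow> real^'x^'x) \<Rightarrow> (nat \<Rightarrow> real^'x^'x) \<Rightarrow> bool" where
  "primitive_idempotent_ordering d A E \<longleftrightarrow>
     bij_betw E {..d} {F. primitive_idempotent (adjacency_algebra d A) F} \<and>
     E 0 = (1 / real CARD('x)) *\<^sub>R all_ones"

definition first_eigenmatrix ::
    "nat \<Rightarrow> (nat \<Rightarrow> real^'x^'x) \<Rightarrow> (nat \<Rightarrow> real^'x^'x) \<Rightarrow> real mat \<Rightarrow> bool" where
  "first_eigenmatrix d A E P \<longleftrightarrow>
     P \<in> carrier_mat (d + 1) (d + 1) \<and>
     (\<forall>i\<le>d. A i = (\<Sum>j\<le>d. P $$ (j, i) *\<^sub>R E j))"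

definition eigenmatrix_P :: "real \<Rightarrow> real \<Rightarrow> real \<Rightarrow> real \<Rightarrow> real mat" where
  "eigenmatrix_P f k m n =
    (let s = sqrt (k * (m * n - k - n)) / sqrt ((m - 1) * (n - 1)) in
     mat_of_rows_list 6
      [[1, n - 1, (m - 1) * n, (f - 1) * k, (f - 1) * (m * n - k - n), (f - 1) * n],
       [1, - 1, 0, (f - 1) * s, - ((f - 1) * s), 0],
       [1, n - 1, - n, - ((f - 1) * k / (m - 1)), (f - 1) * (k + n - m * n) / (m - 1), (f - 1) * n],
       [1, n - 1, - n, k / (m - 1), n - k / (m - 1), - n],
       [1, - 1, 0, - s, s, 0],
       [1, n - 1, (m - 1) * n, - k, k + n - m * n, - n]])"

section \<open>Symmetric group divisible designs\<close>

definition J_mat :: "nat \<Rightarrow> real mat" where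
  "J_mat t = Matrix.mat t t (\<lambda>_. 1)"

definition kronecker :: "real mat \<Rightarrow> real mat \<Rightarrow> real mat" where
  "kronecker A B = Matrix.mat (dim_row A * dim_row B) (dim_col A * dim_col B)
     (\<lambda>(i, j). A $$ (i div dim_row B, j div dim_col B) * B $$ (i mod dim_row B, j mod dim_col B))"

definition K_mat :: "nat \<Rightarrow> nat \<Rightarrow> real mat" where
  "K_mat m n = kronecker (1\<^sub>m m) (J_mat n)"

definition zero_one_mat :: "real mat \<Rightarrow> bool" where
  "zero_one_mat A \<longleftrightarrow> elements_mat A \<subseteq> {0, 1}"

text \<open>
  The parameters \<open>l1\<close> and \<open>l2\<close> are allowed to be real, but as \<open>m, n \<ge> 2\<close> they occur as
  entries of the product of two \<open>(0,1)\<close>-matrices and so are non-negative integers.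
\<close>

definition symmetric_gdd ::
    "real mat \<Rightarrow> nat \<Rightarrow> nat \<Rightarrow> nat \<Rightarrow> nat \<Rightarrow> real \<Rightarrow> real \<Rightarrow> bool" where
  "symmetric_gdd A v k m n l1 l2 \<longleftrightarrow>
     2 \<le> m \<and> 2 \<le> n \<and> v = m * n \<and> A \<in> carrier_mat v v \<and> zero_one_mat A \<and>
     (let R = real k \<cdot>\<^sub>m 1\<^sub>m v + l1 \<cdot>\<^sub>m (K_mat m n - 1\<^sub>m v) + l2 \<cdot>\<^sub>m (J_mat v - K_mat m n)
      in A * transpose_mat A = R \<and> transpose_mat A * A = R)"

definition linked_system_type_II ::
    "nat \<Rightarrow> (nat \<Rightarrow> nat \<Rightarrow> real mat) \<Rightarrow> nat \<Rightarrow> nat \<Rightarrow> nat \<Rightarrow> nat \<Rightarrow> real \<Rightarrow> real \<Rightarrow> bool" where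
  "linked_system_type_II f A v k m n l1 l2 \<longleftrightarrow>
     3 \<le> f \<and>
     (\<forall>i\<in>{1..f}. \<forall>j\<in>{1..f}. i \<noteq> j \<longrightarrow>
        symmetric_gdd (A i j) v k m n l1 l2 \<and> zero_one_mat (A i j + K_mat m n)) \<and>
     (\<exists>\<sigma> \<tau> \<rho> :: nat. \<forall>i\<in>{1..f}. \<forall>j\<in>{1..f}. \<forall>l\<in>{1..f}. i \<noteq> j \<and> j \<noteq> l \<and> i \<noteq> l \<longrightarrow>
        A i j * A j l = real \<sigma> \<cdot>\<^sub>m A i l + real \<tau> \<cdot>\<^sub>m (J_mat v - A i l - K_mat m n)
                        + real \<rho> \<cdot>\<^sub>m K_mat m n)"

end

theory Submission
  imports Defs
begin

text \<open>
  \<open>F = A 0 + A 1 + A 2\<close> and \<open>G = A 0 + A 1 + A 5\<close> are equivalence relations with \<open>f\<close> and \<open>m\<close>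
  classes (the fibres and the groups), any two of which meet in \<open>n\<close> vertices; the designs are the
  blocks of \<open>A 3\<close> between two fibres.  A product of two such blocks is a block of \<open>A 3 D A 3\<close>,
  where \<open>D\<close> is the diagonal projection onto the middle fibre, whereas the algebra only contains
  \<open>A 3 A 3\<close>, the sum over all fibres.  The point is that the summands agree.  Indeed
  \<open>M = f E 1\<close> has the rank of each of its diagonal blocks, so \<open>M D M = M\<close>, and
  \<open>A 3 = s (M - Q) + (c / n) (A 3 + A 4)\<close> with \<open>c = k / (m - 1)\<close> and \<open>Q = E 1 + E 4\<close>, where the paths
  contributed by \<open>A 3 + A 4\<close> can be counted directly.
\<close>

section \<open>Idempotents\<close>

lemma matrix_sub_ldistrib: "X ** (Y - Z) = X ** Y - X ** (Z :: real^'a^'b)"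
  by (simp add: Finite_Cartesian_Product.vec_eq_iff matrix_matrix_mult_def algebra_simps sum_subtractf)

lemma matrix_sub_rdistrib: "(Y - Z) ** X = Y ** X - Z ** (X :: real^'a^'b)"
  by (simp add: Finite_Cartesian_Product.vec_eq_iff matrix_matrix_mult_def algebra_simps sum_subtractf)

lemmas matrix_scaleR_left = scalar_matrix_assoc[symmetric]

lemma matrix_scaleR_right: "Y ** (r *\<^sub>R X) = r *\<^sub>R (Y ** (X :: real^'a^'b))"
  by (simp add: matrix_scalar_ac matrix_scaleR_left)

lemma matrix_add_rdistrib: "(Y + Z) ** X = Y ** X + Z ** (X :: real^'a^'b)"
  by (simp add: Finite_Cartesian_Product.vec_eq_iff matrix_matrix_mult_def algebra_simps sum.distrib)

lemma matrix_sum_left: "(\<Sum>i\<in>I. Y i) ** X = (\<Sum>i\<in>I. Y i ** (X :: real^'a^'b))"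
  by (induction I rule: infinite_finite_induct) (auto simp: matrix_add_rdistrib)

lemma matrix_sum_right: "X ** (\<Sum>i\<in>I. Y i) = (\<Sum>i\<in>I. X ** (Y i :: real^'a^'b))"
  by (induction I rule: infinite_finite_induct) (auto simp: matrix_add_ldistrib)

lemma matrix_mul_component: "(X ** Y) $ x $ y = (\<Sum>z\<in>UNIV. X $ x $ z * Y $ z $ y)"
  by (simp add: matrix_matrix_mult_def)

lemma trace_scaleR: "trace (r *\<^sub>R X) = r * trace (X :: real^'a^'a)"
  by (simp add: trace_def sum_distrib_left)

text \<open>For symmetric \<open>S\<close> the trace of \<open>S ** S\<close> is the sum of the
  squares of all entries.\<close>

lemma symmetric_trace_square_zero:
  fixes S :: "real^'a^'a"
  assumes "transpose S = S" "trace (S ** S) = 0"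
  shows "S = 0"
proof -
  have sym: "S $ y $ x = S $ x $ y" for x y
    using assms(1) by (metis transpose_def vec_lambda_beta)
  have "(\<Sum>x\<in>UNIV. \<Sum>y\<in>UNIV. (S $ x $ y)\<^sup>2) = 0"
    using assms(2) by (simp add: trace_def matrix_mul_component sym power2_eq_square)
  then have "(\<Sum>y\<in>UNIV. (S $ x $ y)\<^sup>2) = 0" for x
    by (subst (asm) sum_nonneg_eq_0_iff) (auto intro: sum_nonneg)
  then have "S $ x $ y = 0" for x y
    by (subst (asm) sum_nonneg_eq_0_iff) auto
  then show ?thesis by (simp add: Finite_Cartesian_Product.vec_eq_iff)
qed

text \<open>\<open>(M - M D M) / f\<close> is a symmetric idempotent of trace 0.\<close>

lemma compress_expand:
  fixes M Q D :: "real^'a^'a"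
  assumes sym: "transpose M = M" "transpose D = D"
    and MM: "M ** M = f *\<^sub>R M" and QM: "Q ** M = M"
    and DD: "D ** D = D" and DMD: "D ** M ** D = D ** Q"
    and tr: "trace M = f * trace (D ** Q)"
  shows "M ** D ** M = M"
proof -
  define W where "W = M ** D ** M"
  define S where "S = M - W"
  have MW: "M ** W = f *\<^sub>R W" and WM: "W ** M = f *\<^sub>R W"
  proof -
    have "M ** W = M ** M ** D ** M" by (simp add: W_def matrix_mul_assoc)
    then show "M ** W = f *\<^sub>R W" by (simp add: MM W_def matrix_scaleR_left)
    have "W ** M = M ** D ** (M ** M)" by (simp add: W_def matrix_mul_assoc)
    then show "W ** M = f *\<^sub>R W" by (simp add: MM W_def matrix_scaleR_right)
  qed
  \<comment> \<open>The inner \<open>M ** M\<close> becomes \<open>f *\<^sub>R M\<close>, which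
    exposes \<open>D ** M ** D\<close>. This collapses to \<open>D ** Q\<close>, and
    \<open>Q\<close> is absorbed by the last \<open>M\<close>.\<close>
  have "W ** W = M ** D ** (M ** M) ** D ** M"
    by (simp add: W_def matrix_mul_assoc)
  also have "\<dots> = f *\<^sub>R (M ** (D ** M ** D) ** M)"
    by (simp add: MM matrix_scaleR_left matrix_scaleR_right matrix_mul_assoc)
  also have "\<dots> = f *\<^sub>R (M ** D ** (Q ** M))"
    by (simp add: DMD matrix_mul_assoc)
  finally have WW: "W ** W = f *\<^sub>R W" by (simp add: QM W_def)
  have SS: "S ** S = f *\<^sub>R S"
    by (simp add: S_def matrix_sub_ldistrib matrix_sub_rdistrib MM MW WM WW algebra_simps)
  \<comment> \<open>Cyclicity of the trace turns \<open>W\<close> into \<open>f\<close> times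
    \<open>D ** M ** D\<close>, hence into \<open>f\<close> times \<open>D ** Q\<close>, whose trace
    \<open>tr\<close> compares with that of \<open>M\<close>.\<close>
  have "trace W = trace (M ** M ** D)"
    unfolding W_def by (subst trace_mul_sym) (simp add: matrix_mul_assoc)
  also have "\<dots> = f * trace (M ** (D ** D))"
    by (simp add: MM matrix_scaleR_left trace_scaleR DD)
  also have "trace (M ** (D ** D)) = trace (D ** M ** D)"
    using trace_mul_sym[of "M ** D" D] by (simp add: matrix_mul_assoc)
  finally have "trace S = 0" by (simp add: S_def trace_sub tr DMD)
  then have "trace (S ** S) = 0" by (simp add: SS trace_scaleR)
  moreover have "transpose S = S"
  proof -
    have "transpose W = W"
      by (simp add: W_def matrix_transpose_mul sym matrix_mul_assoc)
    then show ?thesis using sym(1) by (simp add: S_def transpose_def Finite_Cartesian_Product.vec_eq_iff)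
  qed
  ultimately have "S = 0" by (intro symmetric_trace_square_zero)
  then show ?thesis by (simp add: S_def W_def)
qed

section \<open>The adjacency algebra and its primitive idempotents\<close>

lemma adjacency_algebra_mult:
  assumes "intersection_numbers d A p"
    and "X \<in> adjacency_algebra d A" "Y \<in> adjacency_algebra d A"
  shows "X ** Y \<in> adjacency_algebra d A"
proof -
  have gen: "A i ** A j \<in> span (A ` {..d})" if "i \<le> d" "j \<le> d" for i j
  proof -
    have "A i ** A j = (\<Sum>k\<le>d. real (p i j k) *\<^sub>R A k)"
      using assms(1) that by (auto simp: intersection_numbers_def)
    moreover have "(\<Sum>k\<le>d. real (p i j k) *\<^sub>R A k) \<in> span (A ` {..d})"
      by (intro span_sum span_scale span_base imageI)
    ultimately show ?thesis by simp
  qed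
  have right: "A i ** Y \<in> span (A ` {..d})" if "i \<le> d" for i
    using assms(3) unfolding adjacency_algebra_def
  proof (induction rule: span_induct_alt)
    case base
    then show ?case by (simp add: span_zero)
  next
    case (step r Z W)
    then have "A i ** Z \<in> span (A ` {..d})" using gen that by blast
    with step.IH show ?case
      by (simp add: matrix_add_ldistrib matrix_scaleR_right span_add span_scale)
  qed
  show ?thesis
    using assms(2) unfolding adjacency_algebra_def
  proof (induction rule: span_induct_alt)
    case base
    then show ?case by (simp add: span_zero)
  next
    case (step r Z W)
    then have "Z ** Y \<in> span (A ` {..d})" using right by blast
    with step.IH show ?case
      by (simp add: matrix_add_rdistrib matrix_scaleR_left span_add span_scale)
  qed
qed

lemma adjacency_algebra_symmetric:
  assumes "\<And>i. i \<le> d \<Longrightarrow> transpose (A i) = A i" and "X \<in> adjacency_algebra d A"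
  shows "transpose X = X"
  using assms(2) unfolding adjacency_algebra_def
proof (induction rule: span_induct_alt)
  case base
  then show ?case by (simp add: transpose_def Finite_Cartesian_Product.vec_eq_iff)
next
  case (step r Z W)
  then have "transpose Z = Z" using assms(1) by blast
  moreover have "transpose (r *\<^sub>R Z + W) = r *\<^sub>R transpose Z + transpose W"
    by (simp add: transpose_def Finite_Cartesian_Product.vec_eq_iff)
  ultimately show ?case using step.IH by simp
qed

text \<open>All elements of the algebra are symmetric, the product included, and transposition
  reverses a product.\<close>

lemma adjacency_algebra_commute:
  assumes "symmetric_association_scheme d A"
    and "X \<in> adjacency_algebra d A" "Y \<in> adjacency_algebra d A"
  shows "X ** Y = Y ** X"
proof -
  obtain p where p: "intersection_numbers d A p"
    using assms(1) by (auto simp: symmetric_association_scheme_def)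
  have sym: "transpose Z = Z" if "Z \<in> adjacency_algebra d A" for Z
  proof (rule adjacency_algebra_symmetric[OF _ that])
    show "transpose (A i) = A i" if "i \<le> d" for i
      using assms(1) that unfolding symmetric_association_scheme_def by blast
  qed
  have "X ** Y = transpose (X ** Y)" 
    by (rule sym[OF adjacency_algebra_mult[OF p assms(2,3)], symmetric])
  also have "\<dots> = Y ** X" by (simp only: matrix_transpose_mul sym[OF assms(2)] sym[OF assms(3)])
  finally show ?thesis .
qed

text \<open>If \<open>X ** Y\<close> is non-zero, then \<open>X = X ** Y + (X - X ** Y)\<close> is a
  sum of orthogonal idempotents of the algebra, so primitivity of \<open>X\<close> forces
  \<open>X ** Y = X\<close>. Applied in both orders this gives
  \<open>F = F ** G = G ** F = G\<close>.\<close>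

lemma primitive_idempotents_orthogonal:
  assumes scheme: "symmetric_association_scheme d A"
    and prim: "primitive_idempotent (adjacency_algebra d A) F"
      "primitive_idempotent (adjacency_algebra d A) G"
    and "F \<noteq> G"
  shows "F ** G = 0"
proof (rule ccontr)
  assume nz: "F ** G \<noteq> 0"
  obtain p where p: "intersection_numbers d A p"
    using scheme by (auto simp: symmetric_association_scheme_def)
  have absorb: "X ** Y = X"
    if X: "primitive_idempotent (adjacency_algebra d A) X"
      and Y: "primitive_idempotent (adjacency_algebra d A) Y" and nz: "X ** Y \<noteq> 0" for X Y
  proof (rule ccontr)
    assume ne: "X ** Y \<noteq> X"
    have mem: "X \<in> adjacency_algebra d A" "Y \<in> adjacency_algebra d A"
      and id: "X ** X = X" "Y ** Y = Y"
      using X Y by (auto simp: primitive_idempotent_def)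
    note comm = adjacency_algebra_commute[OF scheme mem]
    have XXY: "X ** (X ** Y) = X ** Y" by (simp add: matrix_mul_assoc id)
    have XYX: "X ** Y ** X = X ** Y"
    proof -
      have "X ** Y ** X = X ** (Y ** X)" by (simp add: matrix_mul_assoc)
      also have "\<dots> = X ** Y" by (simp add: comm[symmetric] XXY)
      finally show ?thesis .
    qed
    have XYXY: "X ** Y ** (X ** Y) = X ** Y"
    proof -
      have "X ** Y ** (X ** Y) = X ** Y ** X ** Y" by (simp add: matrix_mul_assoc)
      also have "\<dots> = X ** (Y ** Y)" by (simp only: XYX matrix_mul_assoc)
      finally show ?thesis by (simp add: id)
    qed
    have XY: "X ** Y \<in> adjacency_algebra d A"
      by (rule adjacency_algebra_mult[OF p mem])
    moreover have "X - X ** Y \<in> adjacency_algebra d A"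
      using XY mem by (simp add: adjacency_algebra_def span_diff)
    moreover have "(X - X ** Y) ** (X - X ** Y) = X - X ** Y"
      "X ** Y ** (X - X ** Y) = 0" "(X - X ** Y) ** (X ** Y) = 0"
      by (simp_all add: matrix_sub_ldistrib matrix_sub_rdistrib id XXY XYX XYXY)
    moreover have "X - X ** Y \<noteq> 0" "X = X ** Y + (X - X ** Y)" using ne by auto
    moreover have "\<not> (\<exists>F\<in>adjacency_algebra d A. \<exists>G\<in>adjacency_algebra d A. F \<noteq> 0 \<and> G \<noteq> 0 \<and>
        F ** F = F \<and> G ** G = G \<and> F ** G = 0 \<and> G ** F = 0 \<and> X = F + G)"
      using X by (simp add: primitive_idempotent_def)
    ultimately show False using nz XYXY by metis
  qed
  have comm: "F ** G = G ** F"
    using adjacency_algebra_commute[OF scheme] prim by (auto simp: primitive_idempotent_def)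
  have "F = F ** G" using absorb[OF prim nz] by (rule sym)
  also have "\<dots> = G ** F" by (rule comm)
  also have "\<dots> = G" using nz unfolding comm by (rule absorb[OF prim(2,1)])
  finally show False using \<open>F \<noteq> G\<close> by contradiction
qed

section \<open>Coordinates from two equivalence relations\<close>

lemma card_quotient_uniform:
  fixes R :: "('x :: finite) rel"
  assumes "equiv UNIV R" "\<And>x. card (R `` {x}) = t"
  shows "t * card (UNIV // R) = CARD('x)"
proof -
  have "t * card (UNIV // R) = card (\<Union>(UNIV // R))"
    using assms quotient_disj[OF assms(1)]
    by (intro card_partition) (auto simp: quotient_def)
  then show ?thesis by (simp add: Union_quotient[OF assms(1)])
qed

lemma equiv_class_mem_iff:
  assumes "equiv UNIV R" and "x \<in> R `` {w}"
  shows "(x, y) \<in> R \<longleftrightarrow> y \<in> R `` {w}"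
proof -
  have sym: "sym R" and trans: "trans R" using assms(1) by (auto elim: equivE)
  have wx: "(w, x) \<in> R" using assms(2) by simp
  show ?thesis using transD[OF trans wx] transD[OF trans symD[OF sym wx]] by auto
qed

text \<open>The classes of \<open>R\<close>, the classes of \<open>S\<close> and the
  \<open>n\<close> points of each intersection are numbered separately. Class, class and position
  together determine a vertex.\<close>

lemma coordinates:
  fixes R S :: "('x :: finite) rel"
  assumes eq: "equiv UNIV R" "equiv UNIV S"
    and card: "card (UNIV // R) = f" "card (UNIV // S) = m"
    and int: "\<And>x y. card (R `` {x} \<inter> S `` {y}) = n" and "n > 0"
  obtains pt :: "nat \<Rightarrow> nat \<Rightarrow> 'x" where
    "\<And>i j a b. i \<in> {1..f} \<Longrightarrow> j \<in> {1..f} \<Longrightarrow> a < m * n \<Longrightarrow> b < m * n \<Longrightarrow>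
       (pt i a, pt j b) \<in> R \<longleftrightarrow> i = j"
    "\<And>i j a b. i \<in> {1..f} \<Longrightarrow> j \<in> {1..f} \<Longrightarrow> a < m * n \<Longrightarrow> b < m * n \<Longrightarrow>
       (pt i a, pt j b) \<in> S \<longleftrightarrow> a div n = b div n"
    "bij_betw (\<lambda>(i, a). pt i a) ({1..f} \<times> {..<m * n}) UNIV"
proof -
  obtain \<phi> where \<phi>: "bij_betw \<phi> {1..f} (UNIV // R)"
    using ex_bij_betw_nat_finite_1[of "UNIV // R"] card by auto
  obtain \<psi> where \<psi>: "bij_betw \<psi> {0..<m} (UNIV // S)"
    using ex_bij_betw_nat_finite[of "UNIV // S"] card by auto
  have \<phi>_mem: "\<phi> i \<in> UNIV // R" if "i \<in> {1..f}" for i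
    using bij_betwE[OF \<phi>] that by auto
  have \<psi>_mem: "\<psi> g \<in> UNIV // S" if "g < m" for g
    using bij_betwE[OF \<psi>] that by auto
  have "\<exists>e. bij_betw e {0..<n} (\<phi> i \<inter> \<psi> g)" if "i \<in> {1..f}" "g < m" for i g
  proof -
    have "card (\<phi> i \<inter> \<psi> g) = n"
      using \<phi>_mem[OF that(1)] \<psi>_mem[OF that(2)] int by (auto simp: quotient_def)
    then show ?thesis using ex_bij_betw_nat_finite[of "\<phi> i \<inter> \<psi> g"] by auto
  qed
  then obtain e where e: "\<And>i g. i \<in> {1..f} \<Longrightarrow> g < m \<Longrightarrow> bij_betw (e i g) {0..<n} (\<phi> i \<inter> \<psi> g)"
    by metis
  \<comment> \<open>The index \<open>a\<close> encodes group \<open>a div n\<close> and position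
    \<open>a mod n\<close>, the row convention of the Kronecker product in
    \<open>K_mat\<close>.\<close>
  define pt where "pt i a = e i (a div n) (a mod n)" for i a
  have div: "a div n < m" if "a < m * n" for a
    using that by (rule less_mult_imp_div_less)
  have pt: "pt i a \<in> \<phi> i \<inter> \<psi> (a div n)" if "i \<in> {1..f}" "a < m * n" for i a
    using bij_betwE[OF e[OF that(1) div[OF that(2)]]] \<open>n > 0\<close> by (auto simp: pt_def)
  have R: "(pt i a, pt j b) \<in> R \<longleftrightarrow> i = j"
    if "i \<in> {1..f}" "j \<in> {1..f}" "a < m * n" "b < m * n" for i j a b
  proof -
    have "(pt i a, pt j b) \<in> R \<longleftrightarrow> \<phi> i = \<phi> j"
      using quotient_eq_iff[OF eq(1) \<phi>_mem \<phi>_mem] pt that by (metis IntD1)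
    also have "\<dots> \<longleftrightarrow> i = j"
      using inj_on_eq_iff[OF bij_betw_imp_inj_on[OF \<phi>]] that by blast
    finally show ?thesis .
  qed
  have S: "(pt i a, pt j b) \<in> S \<longleftrightarrow> a div n = b div n"
    if "i \<in> {1..f}" "j \<in> {1..f}" "a < m * n" "b < m * n" for i j a b
  proof -
    have "(pt i a, pt j b) \<in> S \<longleftrightarrow> \<psi> (a div n) = \<psi> (b div n)"
      using quotient_eq_iff[OF eq(2) \<psi>_mem[OF div] \<psi>_mem[OF div]] pt that by (metis IntD2)
    also have "\<dots> \<longleftrightarrow> a div n = b div n"
      using inj_on_eq_iff[OF bij_betw_imp_inj_on[OF \<psi>]] that div by auto
    finally show ?thesis .
  qed
  have reflR: "(x, x) \<in> R" and reflS: "(x, x) \<in> S" for x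
    using eq by (simp_all add: equiv_def refl_on_def)
  have "inj_on (\<lambda>(i, a). pt i a) ({1..f} \<times> {..<m * n})"
  proof (rule inj_onI, clarsimp)
    fix i a j b
    assume *: "pt i a = pt j b" "Suc 0 \<le> i" "i \<le> f" "Suc 0 \<le> j" "j \<le> f" "a < m * n" "b < m * n"
    have ij: "i = j" using R[of i j a b] * reflR[of "pt i a"] by simp
    moreover have ab: "a div n = b div n" using S[of i j a b] * reflS[of "pt i a"] by simp
    moreover have "a mod n = b mod n"
    proof -
      have "i \<in> {1..f}" using * by auto
      from bij_betw_imp_inj_on[OF e[OF this div[OF *(6)]]]
      have "inj_on (e i (a div n)) {0..<n}" .
      then show ?thesis
        by (rule inj_onD) (use *(1) ij ab \<open>n > 0\<close> in \<open>simp_all add: pt_def\<close>)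
    qed
    ultimately show "i = j \<and> a = b" by (metis div_mult_mod_eq)
  qed
  moreover have "x \<in> (\<lambda>(i, a). pt i a) ` ({1..f} \<times> {..<m * n})" for x
  proof -
    have "R `` {x} \<in> UNIV // R" "S `` {x} \<in> UNIV // S" by (auto simp: quotient_def)
    then obtain i g where i: "i \<in> {1..f}" "\<phi> i = R `` {x}" and g: "g < m" "\<psi> g = S `` {x}"
      using bij_betw_imp_surj_on[OF \<phi>] bij_betw_imp_surj_on[OF \<psi>]
      by (metis atLeastLessThan_iff imageE)
    have "x \<in> \<phi> i \<inter> \<psi> g" using i g reflR reflS by auto
    then obtain r where r: "r < n" "x = e i g r"
      using bij_betw_imp_surj_on[OF e[OF i(1) g(1)]] by (metis atLeastLessThan_iff imageE)
    have "g * n + r < Suc g * n" using r by simp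
    also have "\<dots> \<le> m * n" using g by (intro mult_le_mono1) simp
    finally have "g * n + r < m * n" .
    moreover have "pt i (g * n + r) = x" using r by (simp add: pt_def)
    ultimately show ?thesis using i by (force intro!: image_eqI[of _ _ "(i, g * n + r)"])
  qed
  ultimately have "bij_betw (\<lambda>(i, a). pt i a) ({1..f} \<times> {..<m * n}) UNIV"
    by (auto simp: bij_betw_def)
  with R S show ?thesis by (rule that)
qed

section \<open>Relations given by (0,1)-matrices, and restriction to a set of vertices\<close>

definition matrix_rel :: "real^'x^'x \<Rightarrow> 'x rel" where
  "matrix_rel B = {(x, y). B $ x $ y = 1}"

text \<open>For transitivity, a path from \<open>x\<close> over \<open>y\<close> to \<open>z\<close>
  makes the entry of \<open>B ** B\<close> at least 1, as no summand is negative; so the entry of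
  \<open>B\<close> cannot be 0.\<close>

lemma equiv_matrix_rel:
  fixes B :: "real^'x^'x"
  assumes zo: "\<And>x y. B $ x $ y \<in> {0, 1}" and sym: "\<And>x y. B $ x $ y = B $ y $ x"
    and diag: "\<And>x. B $ x $ x = 1" and sq: "B ** B = t *\<^sub>R B"
  shows "equiv UNIV (matrix_rel B)"
proof (rule equivI)
  show "refl (matrix_rel B)" by (auto simp: refl_on_def matrix_rel_def diag)
  show "sym_on UNIV (matrix_rel B)" by (auto simp: sym_on_def matrix_rel_def sym)
  show "trans_on UNIV (matrix_rel B)"
  proof (rule transI)
    fix x y z assume "(x, y) \<in> matrix_rel B" "(y, z) \<in> matrix_rel B"
    then have xy: "B $ x $ y = 1" "B $ y $ z = 1" by (auto simp: matrix_rel_def)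
    have nn: "0 \<le> B $ x $ w * B $ w $ z" for w using zo[of x w] zo[of w z] by auto
    have "B $ x $ y * B $ y $ z \<le> (\<Sum>w\<in>UNIV. B $ x $ w * B $ w $ z)"
      by (intro member_le_sum nn) auto
    then have "t * B $ x $ z \<ge> 1"
      using arg_cong[OF sq, of "\<lambda>X. X $ x $ z"] xy by (simp add: matrix_mul_component)
    then show "(x, z) \<in> matrix_rel B" using zo[of x z] by (auto simp: matrix_rel_def)
  qed
qed auto

lemma sum_eq_card_matrix_rel:
  fixes B C :: "real^'x^'x"
  assumes "\<And>x y. B $ x $ y \<in> {0, 1}" "\<And>x y. C $ x $ y \<in> {0, 1}"
    and sym: "\<And>x y. C $ x $ y = C $ y $ x"
  shows "(B ** C) $ x $ y = real (card (matrix_rel B `` {x} \<inter> matrix_rel C `` {y}))"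
proof -
  have "(B ** C) $ x $ y = (\<Sum>z\<in>UNIV. B $ x $ z * C $ y $ z)"
    by (simp add: matrix_mul_component sym[of _ y])
  also have "\<dots> = (\<Sum>z\<in>UNIV. if z \<in> matrix_rel B `` {x} \<inter> matrix_rel C `` {y} then 1 else 0)"
    using assms(1,2) by (intro sum.cong refl) (fastforce simp: matrix_rel_def)
  also have "\<dots> = real (card (matrix_rel B `` {x} \<inter> matrix_rel C `` {y}))"
    by (subst sum.mono_neutral_right[where S = "matrix_rel B `` {x} \<inter> matrix_rel C `` {y}"]) simp_all
  finally show ?thesis .
qed

text \<open>The diagonal projection onto the coordinates in \<open>C\<close>. Placed between two
  factors it confines the middle vertex of a path to \<open>C\<close>.\<close>

definition restrict_mat :: "'x set \<Rightarrow> real^'x^'x" where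
  "restrict_mat C = (\<chi> x y. if x = y \<and> x \<in> C then 1 else 0)"

lemma restrict_mat_left: "(restrict_mat C ** Z) $ x $ y = (if x \<in> C then Z $ x $ y else 0)"
proof -
  have "(restrict_mat C ** Z) $ x $ y = (\<Sum>z\<in>UNIV. if z = x then if x \<in> C then Z $ x $ y else 0 else 0)"
    unfolding matrix_mul_component by (intro sum.cong) (auto simp: restrict_mat_def)
  then show ?thesis by simp
qed

lemma restrict_mat_right: "(Z ** restrict_mat C) $ x $ y = (if y \<in> C then Z $ x $ y else 0)"
proof -
  have "(Z ** restrict_mat C) $ x $ y = (\<Sum>z\<in>UNIV. if z = y then if y \<in> C then Z $ x $ y else 0 else 0)"
    unfolding matrix_mul_component by (intro sum.cong) (auto simp: restrict_mat_def)
  then show ?thesis by simp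
qed

lemma restrict_mat_middle:
  "(Y ** restrict_mat C ** Z) $ x $ y = (\<Sum>z\<in>C. Y $ x $ z * Z $ z $ y)"
proof -
  have "(Y ** restrict_mat C ** Z) $ x $ y = (\<Sum>z\<in>UNIV. if z \<in> C then Y $ x $ z * Z $ z $ y else 0)"
    unfolding matrix_mul_component[of "Y ** restrict_mat C"]
    by (intro sum.cong) (auto simp: restrict_mat_right)
  then show ?thesis by (simp add: sum.If_cases)
qed

section \<open>The algebra of the scheme\<close>

text \<open>Both bounds on \<open>k\<close> are strict so that the eigenvalue \<open>s\<close> is
  positive and can be cancelled.\<close>

locale five_class_scheme =
  fixes f k m n :: nat
    and A E :: "nat \<Rightarrow> real^'x^'x"
    and p :: "nat \<Rightarrow> nat \<Rightarrow> nat \<Rightarrow> nat"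
  assumes f: "2 \<le> f" and m: "1 < m" and n: "1 < n" and k: "0 < k" "k < (m - 1) * n"
    and scheme: "symmetric_association_scheme 5 A"
    and numbers: "intersection_numbers 5 A p"
    and ordering: "primitive_idempotent_ordering 5 A E"
    and eigenmatrix: "first_eigenmatrix 5 A E (eigenmatrix_P (real f) (real k) (real m) (real n))"
begin

section \<open>Spectral coordinates of the algebra\<close>

definition s :: real where
  "s = sqrt (real k * (real m * real n - real k - real n)) / sqrt ((real m - 1) * (real n - 1))"

text \<open>The eigenvalue of \<open>A 3\<close> on \<open>E 3\<close>. The ratio
  \<open>c / n\<close> is the valency of \<open>A 3\<close> divided by that of
  \<open>A 3 + A 4\<close>.\<close>

definition c :: real where "c = real k / (real m - 1)"

text \<open>The element of the algebra with eigenvalue \<open>u j\<close> on \<open>E j\<close>. In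
  these coordinates products are pointwise, and a matrix identity follows from six scalar
  ones.\<close>

definition spectral :: "(nat \<Rightarrow> real) \<Rightarrow> real^'x^'x" where
  "spectral u = (\<Sum>j\<le>5. u j *\<^sub>R E j)"

lemma s_pos: "0 < s"
proof -
  have "real k < real ((m - 1) * n)" using k by (simp only: of_nat_less_iff)
  then have "real k + real n < real m * real n" using m by (simp add: of_nat_diff left_diff_distrib del: One_nat_def)
  then have "0 < real k * (real m * real n - real k - real n)" using k by simp
  moreover have "0 < (real m - 1) * (real n - 1)" using m n by simp
  ultimately show ?thesis unfolding s_def by (intro divide_pos_pos) simp_all
qed

lemma E_mult: "E i ** E j = (if i = j then E i else 0)" if "i \<le> 5" "j \<le> 5"
proof -
  have bij: "bij_betw E {..5} {F. primitive_idempotent (adjacency_algebra 5 A) F}"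
    using ordering by (simp add: primitive_idempotent_ordering_def)
  have prim: "primitive_idempotent (adjacency_algebra 5 A) (E i)" if "i \<le> 5" for i
    using bij_betwE[OF bij] that by auto
  show ?thesis
  proof (cases "i = j")
    case True
    then show ?thesis using prim[of i] that by (simp add: primitive_idempotent_def)
  next
    case False
    then have "E i \<noteq> E j" using bij_betw_imp_inj_on[OF bij] that by (auto simp: inj_on_def)
    from primitive_idempotents_orthogonal[OF scheme prim prim this] that False
    show ?thesis by simp
  qed
qed

lemma spectral_mult: "spectral u ** spectral v = spectral (\<lambda>j. u j * v j)"
proof -
  have "spectral u ** spectral v = (\<Sum>i\<le>5. \<Sum>j\<le>5. (u i * v j) *\<^sub>R (E i ** E j))"
  proof -
    have "spectral u ** spectral v = (\<Sum>i\<le>5. u i *\<^sub>R (E i ** spectral v))"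
      by (simp only: spectral_def[of u] matrix_sum_left matrix_scaleR_left)
    then show ?thesis
      by (simp only: spectral_def[of v] matrix_sum_right matrix_scaleR_right scaleR_sum_right
          scaleR_scaleR)
  qed
  also have "\<dots> = (\<Sum>i\<le>5. \<Sum>j\<le>5. if j = i then (u i * v i) *\<^sub>R E i else 0)"
    by (intro sum.cong refl) (auto simp: E_mult)
  finally show ?thesis by (simp add: spectral_def)
qed

lemma spectral_add: "spectral u + spectral v = spectral (\<lambda>j. u j + v j)"
  by (simp add: spectral_def sum.distrib scaleR_add_left)

lemma spectral_diff: "spectral u - spectral v = spectral (\<lambda>j. u j - v j)"
  by (simp add: spectral_def sum_subtractf scaleR_diff_left)

lemma spectral_scaleR: "r *\<^sub>R spectral u = spectral (\<lambda>j. r * u j)"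
  by (simp add: spectral_def scaleR_sum_right)

lemmas spectral_simps = spectral_mult spectral_add spectral_diff spectral_scaleR

lemma spectral_eqI:
  assumes "u 0 = v 0" "u 1 = v 1" "u 2 = v 2" "u 3 = v 3" "u 4 = v 4" "u 5 = v 5"
  shows "spectral u = spectral v"
proof -
  have "u j = v j" if "j \<le> 5" for j
  proof -
    have "j = 0 \<or> j = 1 \<or> j = 2 \<or> j = 3 \<or> j = 4 \<or> j = 5" using that by arith
    then show ?thesis using assms by auto
  qed
  then show ?thesis by (simp add: spectral_def)
qed

lemma A_spectralI:
  fixes i :: nat and u :: "nat \<Rightarrow> real"
  defines "P \<equiv> eigenmatrix_P (real f) (real k) (real m) (real n)"
  assumes "i \<le> 5" "P $$ (0, i) = u 0" "P $$ (1, i) = u 1" "P $$ (2, i) = u 2"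
    "P $$ (3, i) = u 3" "P $$ (4, i) = u 4" "P $$ (5, i) = u 5"
  shows "A i = spectral u"
proof -
  have "A i = spectral (\<lambda>j. P $$ (j, i))"
    using eigenmatrix assms(2) by (simp add: first_eigenmatrix_def spectral_def P_def)
  also have "\<dots> = spectral u" using assms(3-) by (rule spectral_eqI)
  finally show ?thesis .
qed

text \<open>The columns of the first eigenmatrix, rewritten through \<open>c\<close> so that later
  checks involve no division by \<open>m - 1\<close>.\<close>

lemma A_spectral:
  "A 0 = spectral (nth [1, 1, 1, 1, 1, 1])"
  "A 1 = spectral (nth [real n - 1, -1, real n - 1, real n - 1, -1, real n - 1])"
  "A 2 = spectral (nth [(real m - 1) * real n, 0, - real n, - real n, 0,
      (real m - 1) * real n])"
  "A 3 = spectral (nth [(real f - 1) * real k, (real f - 1) * s,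
      - ((real f - 1) * c), c, - s, - real k])"
  "A 4 = spectral (nth [(real f - 1) * (real m * real n - real k - real n),
      - ((real f - 1) * s), - ((real f - 1) * (real n - c)), real n - c, s,
      real k + real n - real m * real n])"
  "A 5 = spectral (nth [(real f - 1) * real n, 0, (real f - 1) * real n,
      - real n, 0, - real n])"
  using m
  by - (rule A_spectralI;
        simp add: eigenmatrix_P_def mat_of_rows_list_def s_def c_def Let_def;
        simp add: field_simps)+

section \<open>Auxiliary matrices and their spectra\<close>

lemma A0: "A 0 = mat 1"
  using scheme unfolding symmetric_association_scheme_def by blast

lemma A_sum: "(\<Sum>i\<le>5. A i) = all_ones"
  using scheme unfolding symmetric_association_scheme_def by blast

lemma A_01: "i \<le> 5 \<Longrightarrow> A i $ x $ y \<in> {0, 1}"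
  using scheme unfolding symmetric_association_scheme_def by blast

lemma A_transpose: "i \<le> 5 \<Longrightarrow> transpose (A i) = A i"
  using scheme unfolding symmetric_association_scheme_def by blast

lemma A_sym: "i \<le> 5 \<Longrightarrow> A i $ x $ y = A i $ y $ x"
  using A_transpose[of i] by (metis transpose_def vec_lambda_beta)

definition F :: "real^'x^'x" where "F = A 0 + A 1 + A 2"
definition G :: "real^'x^'x" where "G = A 0 + A 1 + A 5"
text \<open>The pairs in different fibres and different groups.\<close>

definition H :: "real^'x^'x" where "H = A 3 + A 4"
text \<open>This subtracts from a vector its averages over the sets of \<open>n\<close> vertices
  with common fibre and group. It is block diagonal for the fibres and equals
  \<open>E 1 + E 4\<close>.\<close>

definition Q :: "real^'x^'x" where "Q = A 0 - (1 / real n) *\<^sub>R (A 0 + A 1)"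
text \<open>The factor \<open>f\<close> is the scale at which the diagonal blocks of
  \<open>M\<close> agree with those of \<open>Q\<close>.\<close>

definition M :: "real^'x^'x" where "M = real f *\<^sub>R E 1"

lemma all_ones_spectral: "all_ones = spectral (nth [real (f * m * n), 0, 0, 0, 0, 0])"
proof -
  have "all_ones = A 0 + A 1 + A 2 + A 3 + A 4 + A 5"
    unfolding A_sum[symmetric] by (simp add: numeral_eq_Suc)
  also have "\<dots> = spectral (nth [real (f * m * n), 0, 0, 0, 0, 0])"
    unfolding A_spectral spectral_simps
    by (rule spectral_eqI) (simp_all add: algebra_simps)
  finally show ?thesis .
qed

text \<open>\<open>E 0\<close> is the all-ones matrix divided by the number of vertices, while the
  spectrum of the all-ones matrix gives the divisor \<open>f * m * n\<close>.\<close>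

lemma card_vertices: "CARD('x) = f * m * n"
proof -
  have "E 0 = (1 / real CARD('x)) *\<^sub>R all_ones"
    using ordering by (simp add: primitive_idempotent_ordering_def)
  moreover have "all_ones = real (f * m * n) *\<^sub>R E 0"
    unfolding all_ones_spectral spectral_def by (simp add: numeral_eq_Suc)
  moreover define r where "r = real (f * m * n) / real CARD('x)"
  ultimately have "all_ones = r *\<^sub>R (all_ones :: real^'x^'x)" by simp
  from arg_cong[OF this, of "\<lambda>X. X $ undefined $ undefined"]
  have "real (f * m * n) / real CARD('x) = 1" unfolding r_def[symmetric] by (simp add: all_ones_def)
  then have "real (f * m * n) = real CARD('x)" by (metis divide_eq_1_iff)
  then show ?thesis by (simp only: of_nat_eq_iff)
qed

lemma M_spectral: "M = spectral (nth [0, real f, 0, 0, 0, 0])"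
  by (simp add: M_def spectral_def numeral_eq_Suc)

lemma Q_spectral: "Q = spectral (nth [0, 1, 0, 0, 1, 0])"
  unfolding Q_def A_spectral spectral_simps using n by (intro spectral_eqI) simp_all

lemma F_spectral: "F = spectral (nth [real (m * n), 0, 0, 0, 0, real (m * n)])"
  unfolding F_def A_spectral spectral_simps
  by (rule spectral_eqI) (simp_all add: algebra_simps)

lemma G_spectral: "G = spectral (nth [real (f * n), 0, real (f * n), 0, 0, 0])"
  unfolding G_def A_spectral spectral_simps
  by (rule spectral_eqI) (simp_all add: algebra_simps)

lemma H_spectral: "H = spectral (nth [(real f - 1) * (real m - 1) * real n, 0, - (real f - 1) * real n,
    real n, 0, - (real m - 1) * real n])"
  unfolding H_def A_spectral spectral_simps
  by (rule spectral_eqI) (simp_all add: algebra_simps)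

lemma F_square: "F ** F = real (m * n) *\<^sub>R F"
  unfolding F_spectral spectral_simps by (rule spectral_eqI) simp_all

lemma G_square: "G ** G = real (f * n) *\<^sub>R G"
  unfolding G_spectral spectral_simps by (rule spectral_eqI) simp_all

text \<open>Read entrywise, this says that every fibre meets every group in \<open>n\<close>
  vertices.\<close>

lemma F_mult_G: "F ** G = real n *\<^sub>R all_ones"
  unfolding F_spectral G_spectral all_ones_spectral spectral_simps
  by (rule spectral_eqI) simp_all

lemma A3_mult_ones: "A 3 ** all_ones = ((real f - 1) * real k) *\<^sub>R all_ones"
  unfolding A_spectral all_ones_spectral spectral_simps
  by (rule spectral_eqI) simp_all

text \<open>On \<open>E 1\<close> and \<open>E 4\<close> the matrix \<open>H\<close> vanishes and
  \<open>M - Q\<close> has eigenvalues \<open>f - 1\<close> and \<open>-1\<close>. On the other four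
  idempotents \<open>M - Q\<close> vanishes and the eigenvalues of \<open>A 3\<close> are
  \<open>c / n\<close> times those of \<open>H\<close>.\<close>

lemma A3_split: "A 3 = s *\<^sub>R (M - Q) + (c / real n) *\<^sub>R H"
proof -
  have k_eq: "real k = c * (real m - 1)" using m by (simp add: c_def)
  show ?thesis
    unfolding A_spectral M_spectral Q_spectral H_spectral spectral_simps k_eq using n
    by (intro spectral_eqI) (simp_all add: field_simps)
qed

lemma M_square: "M ** M = real f *\<^sub>R M"
  unfolding M_spectral spectral_simps by (rule spectral_eqI) simp_all

lemma Q_mult: "Q ** M = M" "M ** Q = M" "Q ** Q = Q" "Q ** H = 0" "H ** Q = 0"
proof -
  have 0: "(0 :: real^'x^'x) = spectral (nth [0, 0, 0, 0, 0, 0])"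
    by (simp add: spectral_def numeral_eq_Suc)
  show "Q ** M = M" "M ** Q = M" "Q ** Q = Q" "Q ** H = 0" "H ** Q = 0"
    unfolding M_spectral Q_spectral H_spectral 0 spectral_simps
    by (rule spectral_eqI; simp)+
qed

text \<open>Entries in {0, 1} with sum 1 single out one class, so claims about entries reduce to six
  cases.\<close>

lemma class_cases:
  "\<exists>i\<in>{0, 1, 2, 3, 4, 5 :: nat}. A 0 $ x $ y = of_bool (i = 0) \<and> A 1 $ x $ y = of_bool (i = 1) \<and>
     A 2 $ x $ y = of_bool (i = 2) \<and> A 3 $ x $ y = of_bool (i = 3) \<and>
     A 4 $ x $ y = of_bool (i = 4) \<and> A 5 $ x $ y = of_bool (i = 5)"
proof -
  have "(\<Sum>j\<le>5. A j) $ x $ y = 1" by (simp add: A_sum all_ones_def)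
  then have sum: "(\<Sum>j\<le>5. A j $ x $ y) = 1" by simp
  have "(\<Sum>j\<le>5. A j $ x $ y) \<noteq> 0" unfolding sum by simp
  then obtain i where i: "i \<le> 5" "A i $ x $ y \<noteq> 0"
    by (rule sum.not_neutral_contains_not_neutral) simp
  then have one: "A i $ x $ y = 1" using A_01[of i x y] by auto
  have nonneg: "0 \<le> A j $ x $ y" if "j \<in> {..5} - {i}" for j
    using A_01[of j x y] that by auto
  have "(\<Sum>j\<in>{..5} - {i}. A j $ x $ y) = 0"
    using sum i one by (simp add: sum_diff1)
  then have "\<forall>j\<in>{..5} - {i}. A j $ x $ y = 0"
    using sum_nonneg_eq_0_iff[of "{..5} - {i}" "\<lambda>j. A j $ x $ y"] nonneg by blast
  with one have "A j $ x $ y = of_bool (i = j)" if "j \<le> 5" for j using that by auto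
  moreover have "i \<in> {0, 1, 2, 3, 4, 5}" using i by auto
  ultimately show ?thesis by (intro bexI[of _ i]) simp_all
qed

lemma A_diag:
  "A 0 $ x $ x = 1" "A 1 $ x $ x = 0" "A 2 $ x $ x = 0" "A 3 $ x $ x = 0" "A 4 $ x $ x = 0"
  "A 5 $ x $ x = 0"
proof -
  show *: "A 0 $ x $ x = 1" by (simp add: A0 Finite_Cartesian_Product.mat_def)
  show "A 1 $ x $ x = 0" "A 2 $ x $ x = 0" "A 3 $ x $ x = 0" "A 4 $ x $ x = 0" "A 5 $ x $ x = 0"
    using class_cases[of x x] by (auto simp: *)
qed

lemma M_sym: "transpose M = M"
proof -
  have "E 1 \<in> {F. primitive_idempotent (adjacency_algebra 5 A) F}"
    using ordering by (auto simp: primitive_idempotent_ordering_def dest!: bij_betwE)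
  then have "E 1 \<in> adjacency_algebra 5 A" by (simp add: primitive_idempotent_def)
  from adjacency_algebra_symmetric[OF A_transpose this] have "transpose (E 1) = E 1" .
  then show ?thesis by (simp add: M_def transpose_scalar)
qed

section \<open>Fibres and groups as equivalence classes, and their sizes\<close>

lemma FG_01: "F $ x $ y \<in> {0, 1}" "G $ x $ y \<in> {0, 1}"
  using class_cases[of x y] by (auto simp: F_def G_def)

lemma FG_sym: "F $ x $ y = F $ y $ x" "G $ x $ y = G $ y $ x"
  by (simp_all add: F_def G_def A_sym[of _ x y])

lemma FG_diag: "F $ x $ x = 1" "G $ x $ x = 1"
  by (simp_all add: F_def G_def A_diag del: One_nat_def)

lemma equiv_F: "equiv UNIV (matrix_rel F)"
  by (rule equiv_matrix_rel[OF FG_01(1) FG_sym(1) FG_diag(1) F_square])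

lemma equiv_G: "equiv UNIV (matrix_rel G)"
  by (rule equiv_matrix_rel[OF FG_01(2) FG_sym(2) FG_diag(2) G_square])

lemma card_F: "card (matrix_rel F `` {x}) = m * n"
proof -
  have "(F ** F) $ x $ x = real (m * n)" by (simp add: F_square FG_diag)
  then show ?thesis
    using sum_eq_card_matrix_rel[OF FG_01(1) FG_01(1) FG_sym(1), of x x] by (simp del: of_nat_mult)
qed

lemma card_G: "card (matrix_rel G `` {x}) = f * n"
proof -
  have "(G ** G) $ x $ x = real (f * n)" by (simp add: G_square FG_diag)
  then show ?thesis
    using sum_eq_card_matrix_rel[OF FG_01(2) FG_01(2) FG_sym(2), of x x] by (simp del: of_nat_mult)
qed

lemma card_F_G: "card (matrix_rel F `` {x} \<inter> matrix_rel G `` {y}) = n"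
proof -
  have "(F ** G) $ x $ y = real n" by (simp add: F_mult_G all_ones_def)
  then show ?thesis
    using sum_eq_card_matrix_rel[OF FG_01(1) FG_01(2) FG_sym(2), of x y] by simp
qed

lemma card_quotient_F: "card (UNIV // matrix_rel F) = f"
proof -
  have "m * n * card (UNIV // matrix_rel F) = m * n * f"
    using card_quotient_uniform[OF equiv_F card_F] unfolding card_vertices by (simp only: mult_ac)
  then show ?thesis using m n by auto
qed

lemma card_quotient_G: "card (UNIV // matrix_rel G) = m"
proof -
  have "f * n * card (UNIV // matrix_rel G) = f * n * m"
    using card_quotient_uniform[OF equiv_G card_G] unfolding card_vertices by (simp only: mult_ac)
  then show ?thesis using f n by auto
qed

section \<open>Counting \<open>A 3\<close>-paths of length two through one fibre\<close>

lemma same_fibre_zero: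
  assumes "F $ x $ y = 1"
  shows "A 3 $ x $ y = 0" "A 5 $ x $ y = 0" "H $ x $ y = 0" "M $ x $ y = Q $ x $ y"
proof -
  show *: "A 3 $ x $ y = 0" "A 5 $ x $ y = 0" "H $ x $ y = 0"
    using assms class_cases[of x y] by (auto simp: F_def H_def)
  \<comment> \<open>Inside a fibre \<open>A 3\<close> and \<open>H\<close> vanish, so
    \<open>A3_split\<close> reduces to \<open>s * (M - Q) = 0\<close> there.\<close>
  show "M $ x $ y = Q $ x $ y"
    using arg_cong[OF A3_split, of "\<lambda>X. X $ x $ y"] * s_pos by simp
qed

lemma different_fibre:
  assumes "F $ x $ y = 0"
  shows "H $ x $ y = 1 - G $ x $ y" "Q $ x $ y = 0"
  using assms class_cases[of x y] by (auto simp: F_def H_def G_def Q_def)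

text \<open>The number of \<open>A 3\<close>-paths from \<open>x\<close> to \<open>y\<close> through
  any one fibre containing neither of them. The formula does not mention that fibre; its second
  summand is the contribution of the \<open>H\<close>-paths.\<close>

definition path_count :: "'x \<Rightarrow> 'x \<Rightarrow> real" where
  "path_count x y = s\<^sup>2 * M $ x $ y
     + (c / real n)\<^sup>2 * (real m * real n - 2 * real n + real n * G $ x $ y)"

text \<open>Inclusion-exclusion in a fibre of \<open>m * n\<close> vertices: \<open>n\<close> of
  them lie in the group of \<open>x\<close> and \<open>n\<close> in that of \<open>y\<close>, and
  these sets coincide or are disjoint according to \<open>G $ x $ y\<close>.\<close>

lemma H_paths:
  assumes C: "C = matrix_rel F `` {w}" and "x \<notin> C" "y \<notin> C"
  shows "(H ** restrict_mat C ** H) $ x $ y = real m * real n - 2 * real n + real n * G $ x $ y"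
proof -
  have F0: "F $ x $ z = 0" "F $ z $ y = 0" if "z \<in> C" for z
  proof -
    have "F $ z $ x \<noteq> 1" "F $ z $ y \<noteq> 1"
      using equiv_class_mem_iff[OF equiv_F that[unfolded C]] assms
      unfolding matrix_rel_def by blast+
    then show "F $ x $ z = 0" "F $ z $ y = 0"
      using FG_01(1)[of z x] FG_01(1)[of z y] FG_sym(1)[of x z] by auto
  qed
  have row: "(\<Sum>z\<in>C. G $ v $ z) = real n" for v
  proof -
    have "(\<Sum>z\<in>C. G $ v $ z) = (\<Sum>z\<in>UNIV. if z \<in> C then G $ v $ z else 0)"
      by (simp add: sum.If_cases)
    also have "\<dots> = (F ** G) $ w $ v"
      unfolding matrix_mul_component using FG_01(1)
      by (intro sum.cong refl) (auto simp: C matrix_rel_def FG_sym(2)[of v])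
    finally show ?thesis by (simp add: F_mult_G all_ones_def)
  qed
  \<comment> \<open>If \<open>z\<close> lies in the group of \<open>x\<close>, then \<open>z\<close>
    and \<open>x\<close> have the same relation to \<open>y\<close>.\<close>
  have trans: "G $ x $ z * G $ z $ y = G $ x $ z * G $ x $ y" for z
  proof (cases "G $ x $ z = 1")
    case True
    then have "x \<in> matrix_rel G `` {z}" by (simp add: matrix_rel_def FG_sym(2))
    from equiv_class_mem_iff[OF equiv_G this, of y]
    have "G $ x $ y = 1 \<longleftrightarrow> G $ z $ y = 1" by (simp add: matrix_rel_def)
    then show ?thesis using FG_01(2)[of z y] FG_01(2)[of x y] by auto
  next
    case False
    then show ?thesis using FG_01(2)[of x z] by auto
  qed
  have "(H ** restrict_mat C ** H) $ x $ y = (\<Sum>z\<in>C. (1 - G $ x $ z) * (1 - G $ z $ y))"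
    unfolding restrict_mat_middle by (intro sum.cong refl) (simp add: different_fibre F0)
  also have "\<dots> = (\<Sum>z\<in>C. 1 - G $ x $ z - G $ y $ z + G $ x $ z * G $ x $ y)"
  proof (intro sum.cong refl)
    fix z
    show "(1 - G $ x $ z) * (1 - G $ z $ y) = 1 - G $ x $ z - G $ y $ z + G $ x $ z * G $ x $ y"
      using trans[of z] FG_sym(2)[of z y] by (simp add: algebra_simps)
  qed
  also have "\<dots> = real (card C) - real n - real n + real n * G $ x $ y"
    by (simp add: sum.distrib sum_subtractf row flip: sum_distrib_right)
  finally show ?thesis using card_F by (simp add: C)
qed

text \<open>\<open>Q\<close> is block diagonal, so it commutes with the projection onto a fibre, and
  the block of \<open>M\<close> on that fibre is the block of \<open>Q\<close>. The trace condition
  of \<open>compress_expand\<close> holds because both matrices have constant diagonal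
  \<open>1 - 1 / n\<close> and the vertex set is \<open>f\<close> times as large as
  \<open>C\<close>.\<close>

lemma M_compress:
  assumes C: "C = matrix_rel F `` {w}"
  shows "Q ** restrict_mat C = restrict_mat C ** Q" "M ** restrict_mat C ** M = M"
proof -
  define D where "D = restrict_mat C"
  have same: "F $ x $ y = 1" if "x \<in> C" "y \<in> C" for x y
    using equiv_class_mem_iff[OF equiv_F, of x w y] that by (simp add: C matrix_rel_def)
  have diff: "F $ x $ y = 0" if "x \<in> C \<longleftrightarrow> y \<notin> C" for x y
  proof -
    have "F $ x $ y \<noteq> 1" if "x \<in> C" "y \<notin> C" for x y
      using equiv_class_mem_iff[OF equiv_F, of x w y] that by (simp add: C matrix_rel_def)
    then show ?thesis using that FG_01(1)[of x y] FG_sym(1)[of x y] by auto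
  qed
  show "Q ** restrict_mat C = restrict_mat C ** Q"
    using diff different_fibre(2)
    by (simp add: Finite_Cartesian_Product.vec_eq_iff restrict_mat_left restrict_mat_right)
  have diag: "Q $ x $ x = 1 - 1 / real n" "M $ x $ x = 1 - 1 / real n" for x
    using same_fibre_zero(4)[OF FG_diag(1), of x] by (simp_all add: Q_def A_diag del: One_nat_def)
  have "M ** D ** M = M"
  proof (rule compress_expand[OF M_sym _ M_square Q_mult(1)])
    show "transpose D = D"
      by (simp add: D_def restrict_mat_def transpose_def Finite_Cartesian_Product.vec_eq_iff)
    show "D ** D = D"
      by (simp add: D_def restrict_mat_left Finite_Cartesian_Product.vec_eq_iff)
        (simp add: restrict_mat_def)
    show "D ** M ** D = D ** Q"
      using same same_fibre_zero(4) diff different_fibre(2)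
      by (simp add: D_def restrict_mat_left restrict_mat_right Finite_Cartesian_Product.vec_eq_iff)
    have "trace (D ** Q) = real (card C) * (1 - 1 / real n)"
      by (simp add: trace_def D_def restrict_mat_left diag sum.If_cases)
    then show "trace M = real f * trace (D ** Q)"
      by (simp add: trace_def diag card_vertices C card_F)
  qed
  then show "M ** restrict_mat C ** M = M" by (simp add: D_def)
qed

text \<open>
  The cross terms between the parts \<open>M - Q\<close> and \<open>H\<close> of \<open>A 3\<close> vanish, because \<open>Q\<close> commutes with
  \<open>restrict_mat C\<close>, fixes \<open>M - Q\<close> and kills \<open>H\<close>.
\<close>

lemma A3_paths:
  assumes C: "C = matrix_rel F `` {w}" and xy: "x \<notin> C" "y \<notin> C"
  shows "(A 3 ** restrict_mat C ** A 3) $ x $ y = path_count x y"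
proof -
  define D where "D = restrict_mat C"
  define R where "R = M - Q"
  define t where "t = c / real n"
  have QD: "Q ** D = D ** Q" and MDM: "M ** D ** M = M"
    using M_compress[OF C] by (simp_all add: D_def)
  have RQ: "R ** Q = R" "Q ** R = R"
    by (simp_all add: R_def matrix_sub_ldistrib matrix_sub_rdistrib Q_mult)
  have "R ** D ** H = R ** (Q ** D) ** H" by (simp add: matrix_mul_assoc RQ)
  also have "\<dots> = R ** D ** (Q ** H)" by (simp only: QD matrix_mul_assoc)
  finally have RDH: "R ** D ** H = 0" by (simp add: Q_mult)
  have "H ** D ** R = H ** (D ** Q) ** R" by (simp add: RQ flip: matrix_mul_assoc)
  also have "\<dots> = H ** Q ** D ** R" by (simp only: QD[symmetric] matrix_mul_assoc)
  finally have HDR: "H ** D ** R = 0" by (simp add: Q_mult)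
  have MQD: "M ** D ** Q = M ** D"
    by (metis QD Q_mult(2) matrix_mul_assoc)
  have QDM: "Q ** D ** M = D ** M"
    by (metis QD Q_mult(1) matrix_mul_assoc)
  have QDQ: "Q ** D ** Q = D ** Q"
    by (metis QD Q_mult(3) matrix_mul_assoc)
  have "R ** D ** R = M - M ** D - D ** M + D ** Q"
    by (simp add: R_def matrix_sub_ldistrib matrix_sub_rdistrib MDM MQD QDM QDQ)
  \<comment> \<open>Each of the last three terms has a factor \<open>D\<close> at one end, which
    kills the entry as \<open>x\<close> and \<open>y\<close> lie outside \<open>C\<close>.\<close>
  then have RDR: "(R ** D ** R) $ x $ y = M $ x $ y"
    using xy by (simp add: D_def restrict_mat_left restrict_mat_right)
  have "A 3 ** D ** A 3 = (s *\<^sub>R R + t *\<^sub>R H) ** D ** (s *\<^sub>R R + t *\<^sub>R H)"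
    by (simp add: A3_split R_def t_def)
  also have "\<dots> = s\<^sup>2 *\<^sub>R (R ** D ** R) + t\<^sup>2 *\<^sub>R (H ** D ** H)"
    by (simp add: matrix_add_ldistrib matrix_add_rdistrib matrix_scaleR_left matrix_scaleR_right
        RDH HDR power2_eq_square)
  finally show ?thesis
    using RDR H_paths[OF C xy] by (simp add: path_count_def D_def t_def)
qed

lemma A_mult_entry:
  assumes "i \<le> 5" "j \<le> 5"
  shows "(A i ** A j) $ x $ y = (\<Sum>l\<le>5. real (p i j l) * A l $ x $ y)"
  using numbers assms by (simp add: intersection_numbers_def)

end

section \<open>The designs between the fibres\<close>

locale labelled_scheme = five_class_scheme f k m n A E p
  for f k m n :: nat and A E :: "nat \<Rightarrow> real^'x^'x" and p +
  fixes pt :: "nat \<Rightarrow> nat \<Rightarrow> 'x"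
  assumes F_pt: "\<And>i j a b. i \<in> {1..f} \<Longrightarrow> j \<in> {1..f} \<Longrightarrow> a < m * n \<Longrightarrow> b < m * n \<Longrightarrow>
      (pt i a, pt j b) \<in> matrix_rel F \<longleftrightarrow> i = j"
    and G_pt: "\<And>i j a b. i \<in> {1..f} \<Longrightarrow> j \<in> {1..f} \<Longrightarrow> a < m * n \<Longrightarrow> b < m * n \<Longrightarrow>
      (pt i a, pt j b) \<in> matrix_rel G \<longleftrightarrow> a div n = b div n"
    and bij_pt: "bij_betw (\<lambda>(i, a). pt i a) ({1..f} \<times> {..<m * n}) UNIV"
begin

section \<open>Entries of the classes in coordinates\<close>

lemma F_entry:
  assumes "i \<in> {1..f}" "j \<in> {1..f}" "a < m * n" "b < m * n"
  shows "F $ pt i a $ pt j b = of_bool (i = j)"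
  using F_pt[OF assms] FG_01(1)[of "pt i a" "pt j b"] by (auto simp: matrix_rel_def)

lemma G_entry:
  assumes "i \<in> {1..f}" "j \<in> {1..f}" "a < m * n" "b < m * n"
  shows "G $ pt i a $ pt j b = of_bool (a div n = b div n)"
  using G_pt[OF assms] FG_01(2)[of "pt i a" "pt j b"] by (auto simp: matrix_rel_def)

lemma pt_eq_iff:
  assumes "i \<in> {1..f}" "j \<in> {1..f}" "a < m * n" "b < m * n"
  shows "pt i a = pt j b \<longleftrightarrow> i = j \<and> a = b"
  using inj_on_eq_iff[OF bij_betw_imp_inj_on[OF bij_pt], of "(i, a)" "(j, b)"] assms by auto

lemma sum_points: "(\<Sum>z\<in>UNIV. g z) = (\<Sum>j\<in>{1..f}. \<Sum>a<m * n. g (pt j a))" for g :: "'x \<Rightarrow> real"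
proof -
  have "(\<Sum>z\<in>UNIV. g z) = (\<Sum>x\<in>{1..f} \<times> {..<m * n}. g (case x of (i, a) \<Rightarrow> pt i a))"
    by (rule sum.reindex_bij_betw[OF bij_pt, symmetric])
  then show ?thesis by (simp add: sum.cartesian_product case_prod_unfold)
qed

lemma A_same_fibre:
  assumes "i \<in> {1..f}" "a < m * n" "b < m * n"
  shows "A 0 $ pt i a $ pt i b = of_bool (a = b)"
    "A 1 $ pt i a $ pt i b = of_bool (a \<noteq> b \<and> a div n = b div n)"
    "A 2 $ pt i a $ pt i b = of_bool (a div n \<noteq> b div n)"
    "A 3 $ pt i a $ pt i b = 0" "A 4 $ pt i a $ pt i b = 0" "A 5 $ pt i a $ pt i b = 0"
proof -
  show 0: "A 0 $ pt i a $ pt i b = of_bool (a = b)"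
    using pt_eq_iff[of i i a b] assms by (simp add: A0 Finite_Cartesian_Product.mat_def)
  have FG: "F $ pt i a $ pt i b = 1" "G $ pt i a $ pt i b = of_bool (a div n = b div n)"
    using F_entry[of i i a b] G_entry[of i i a b] assms by simp_all
  show "A 1 $ pt i a $ pt i b = of_bool (a \<noteq> b \<and> a div n = b div n)"
    "A 2 $ pt i a $ pt i b = of_bool (a div n \<noteq> b div n)"
    "A 3 $ pt i a $ pt i b = 0" "A 4 $ pt i a $ pt i b = 0" "A 5 $ pt i a $ pt i b = 0"
    using class_cases[of "pt i a" "pt i b"] FG 0 by (auto simp: F_def G_def split: if_splits)
qed

text \<open>Fibre and group determine the class except for the choice between \<open>A 3\<close> and
  \<open>A 4\<close>, so only the sum of these two is known.\<close>

lemma A_different_fibre: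
  assumes "i \<in> {1..f}" "l \<in> {1..f}" "i \<noteq> l" "a < m * n" "b < m * n"
  shows "A 0 $ pt i a $ pt l b = 0" "A 1 $ pt i a $ pt l b = 0" "A 2 $ pt i a $ pt l b = 0"
    "A 3 $ pt i a $ pt l b + A 4 $ pt i a $ pt l b = of_bool (a div n \<noteq> b div n)"
    "A 5 $ pt i a $ pt l b = of_bool (a div n = b div n)"
proof -
  have FG: "F $ pt i a $ pt l b = 0" "G $ pt i a $ pt l b = of_bool (a div n = b div n)"
    using F_entry[of i l a b] G_entry[of i l a b] assms by simp_all
  show "A 0 $ pt i a $ pt l b = 0" "A 1 $ pt i a $ pt l b = 0" "A 2 $ pt i a $ pt l b = 0"
    "A 3 $ pt i a $ pt l b + A 4 $ pt i a $ pt l b = of_bool (a div n \<noteq> b div n)"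
    "A 5 $ pt i a $ pt l b = of_bool (a div n = b div n)"
    using class_cases[of "pt i a" "pt l b"] FG by (auto simp: F_def G_def split: if_splits)
qed

section \<open>Path counts in coordinates, compared with intersection numbers\<close>

lemma paths_through_fibre:
  assumes "i \<in> {1..f}" "j \<in> {1..f}" "l \<in> {1..f}" "i \<noteq> j" "l \<noteq> j" "a < m * n" "b < m * n"
  shows "(\<Sum>e<m * n. A 3 $ pt i a $ pt j e * A 3 $ pt j e $ pt l b) = path_count (pt i a) (pt l b)"
proof -
  \<comment> \<open>The vertex at position 0 merely represents fibre \<open>j\<close>.\<close>
  define C where "C = matrix_rel F `` {pt j 0}"
  have mn: "0 < m * n" using m n by simp
  have C: "pt i e \<in> C \<longleftrightarrow> i = j" if "i \<in> {1..f}" "e < m * n" for i e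
    using F_pt[OF assms(2) that(1) mn that(2)] by (auto simp: C_def)
  have "path_count (pt i a) (pt l b) = (A 3 ** restrict_mat C ** A 3) $ pt i a $ pt l b"
    by (rule A3_paths[OF C_def, symmetric]) (use assms C in auto)
  also have "\<dots> = (\<Sum>z\<in>UNIV. if z \<in> C then A 3 $ pt i a $ z * A 3 $ z $ pt l b else 0)"
    unfolding restrict_mat_middle by (simp add: sum.If_cases)
  also have "\<dots> = (\<Sum>j'\<in>{1..f}. if j' = j
      then \<Sum>e<m * n. A 3 $ pt i a $ pt j' e * A 3 $ pt j' e $ pt l b else 0)"
    unfolding sum_points by (intro sum.cong refl) (simp add: C)
  also have "\<dots> = (\<Sum>e<m * n. A 3 $ pt i a $ pt j e * A 3 $ pt j e $ pt l b)"
    using assms(2) by (simp add: sum.delta)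
  finally show ?thesis by simp
qed

text \<open>Fibres \<open>i\<close> and \<open>l\<close> contribute nothing because
  \<open>A 3\<close> vanishes inside a fibre; every other fibre contributes the same number. This
  leaves \<open>f - 1\<close> equal terms if \<open>i = l\<close> and \<open>f - 2\<close>
  otherwise.\<close>

lemma A3_square_entry:
  assumes "i \<in> {1..f}" "l \<in> {1..f}" "a < m * n" "b < m * n"
  shows "(A 3 ** A 3) $ pt i a $ pt l b
    = real (card ({1..f} - {i, l})) * path_count (pt i a) (pt l b)"
proof -
  have "(A 3 ** A 3) $ pt i a $ pt l b
      = (\<Sum>j\<in>{1..f}. \<Sum>e<m * n. A 3 $ pt i a $ pt j e * A 3 $ pt j e $ pt l b)"
    by (simp only: matrix_mul_component sum_points)
  also have "\<dots> = (\<Sum>j\<in>{1..f} - {i, l}. \<Sum>e<m * n. A 3 $ pt i a $ pt j e * A 3 $ pt j e $ pt l b)"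
  proof (rule sum.mono_neutral_right)
    show "\<forall>j\<in>{1..f} - ({1..f} - {i, l}).
        (\<Sum>e<m * n. A 3 $ pt i a $ pt j e * A 3 $ pt j e $ pt l b) = 0"
      using assms by (auto intro!: sum.neutral simp: A_same_fibre(4))
  qed auto
  also have "\<dots> = (\<Sum>j\<in>{1..f} - {i, l}. path_count (pt i a) (pt l b))"
    using assms by (intro sum.cong refl paths_through_fibre) auto
  finally show ?thesis by simp
qed

lemma A_mult_entry_expanded:
  assumes "i \<le> 5" "j \<le> 5"
  shows "(A i ** A j) $ x $ y = real (p i j 0) * A 0 $ x $ y + real (p i j 1) * A 1 $ x $ y
    + real (p i j 2) * A 2 $ x $ y + real (p i j 3) * A 3 $ x $ y
    + real (p i j 4) * A 4 $ x $ y + real (p i j 5) * A 5 $ x $ y"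
  unfolding A_mult_entry[OF assms] by (simp add: numeral_eq_Suc)

text \<open>The entries of \<open>A 3\<close> are their own squares, so a diagonal entry of
  \<open>A 3 ** A 3\<close> is a row sum.\<close>

lemma p330: "real (p 3 3 0) = (real f - 1) * real k"
proof -
  fix x :: 'x
  have "real (p 3 3 0) = (A 3 ** A 3) $ x $ x"
    by (subst A_mult_entry_expanded) (simp_all add: A_diag del: One_nat_def)
  also have "\<dots> = (A 3 ** all_ones) $ x $ x"
    unfolding matrix_mul_component
  proof (intro sum.cong refl)
    fix z
    show "A 3 $ x $ z * A 3 $ z $ x = A 3 $ x $ z * all_ones $ z $ x"
      using A_01[of 3 x z] A_sym[of 3 z x] by (auto simp: all_ones_def)
  qed
  also have "\<dots> = (real f - 1) * real k" unfolding A3_mult_ones by (simp add: all_ones_def)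
  finally show ?thesis .
qed

text \<open>Inside a fibre only the classes 0, 1 and 2 occur, and their intersection numbers are
  shared equally by the \<open>f - 1\<close> other fibres. This is where the parameters of the
  designs come from.\<close>

lemma path_count_same_fibre:
  assumes "i \<in> {1..f}" "a < m * n" "b < m * n"
  shows "path_count (pt i a) (pt i b) = (if a = b then real k
    else if a div n = b div n then 1 / (real f - 1) * real (p 3 3 1)
    else 1 / (real f - 1) * real (p 3 3 2))"
proof -
  have "real (card ({1..f} - {i, i})) = real f - 1" using assms f by (simp add: of_nat_diff)
  moreover have "real f - 1 > 0" using f by simp
  ultimately have "path_count (pt i a) (pt i b) = (A 3 ** A 3) $ pt i a $ pt i b / (real f - 1)"
    using A3_square_entry[of i i a b] assms by simp
  also have "(A 3 ** A 3) $ pt i a $ pt i b = (if a = b then (real f - 1) * real k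
    else if a div n = b div n then real (p 3 3 1) else real (p 3 3 2))"
    by (subst A_mult_entry_expanded) (simp_all add: A_same_fibre[OF assms] p330 del: One_nat_def)
  finally show ?thesis using \<open>real f - 1 > 0\<close> by simp
qed

text \<open>Integrality, invisible in the formula with \<open>s\<close> and \<open>c\<close>, is
  inherited from the (0,1) entries; it makes the constants of the linked system natural
  numbers.\<close>

lemma path_count_nat:
  assumes "i \<in> {1..f}" "j \<in> {1..f}" "l \<in> {1..f}" "i \<noteq> j" "l \<noteq> j" "a < m * n" "b < m * n"
  shows "path_count (pt i a) (pt l b) \<in> \<nat>"
proof -
  have "A 3 $ x $ y \<in> \<nat>" for x y using A_01[of 3 x y] by auto
  then have "(\<Sum>e\<in>I. A 3 $ pt i a $ pt j e * A 3 $ pt j e $ pt l b) \<in> \<nat>" for I :: "nat set"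
    by (induction I rule: infinite_finite_induct) simp_all
  then show ?thesis using paths_through_fibre[OF assms] by metis
qed

text \<open>\<open>f - 2\<close> equal natural numbers add up to the intersection number of the
  class of the pair. Hence \<open>div\<close> is exact for every class that occurs here, namely 3, 4
  or 5.\<close>

lemma path_count_different_fibre:
  assumes "i \<in> {1..f}" "j \<in> {1..f}" "l \<in> {1..f}" "i \<noteq> j" "j \<noteq> l" "i \<noteq> l" "a < m * n" "b < m * n"
  shows "path_count (pt i a) (pt l b) = real (p 3 3 3 div (f - 2)) * A 3 $ pt i a $ pt l b
    + real (p 3 3 4 div (f - 2)) * (1 - A 3 $ pt i a $ pt l b - of_bool (a div n = b div n))
    + real (p 3 3 5 div (f - 2)) * of_bool (a div n = b div n)"
proof -
  obtain t where t: "path_count (pt i a) (pt l b) = real t"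
    using path_count_nat[of i j l a b] assms by (auto elim: Nats_cases)
  have "card {i, j, l} \<le> card {1..f}" using assms by (intro card_mono) auto
  then have f3: "3 \<le> f" using assms by simp
  have card: "card ({1..f} - {i, l}) = f - 2" using assms by (subst card_Diff_subset) auto
  have div: "real t = real (q div (f - 2))" if "real (f - 2) * real t = real q" for q
  proof -
    have "(f - 2) * t = q" using that by (metis of_nat_eq_iff of_nat_mult)
    then show ?thesis using f3 by auto
  qed
  have eq: "real (f - 2) * real t = real (p 3 3 3) * A 3 $ pt i a $ pt l b
    + real (p 3 3 4) * A 4 $ pt i a $ pt l b + real (p 3 3 5) * of_bool (a div n = b div n)"
    using A3_square_entry[of i l a b] assms card t
      A_mult_entry_expanded[of 3 3 "pt i a" "pt l b"]
    by (simp add: A_different_fibre del: One_nat_def)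
  have A4: "A 4 $ pt i a $ pt l b = 1 - of_bool (a div n = b div n) - A 3 $ pt i a $ pt l b"
    using A_different_fibre(4)[of i l a b] assms by auto
  consider "A 3 $ pt i a $ pt l b = 1" "a div n \<noteq> b div n"
    | "A 3 $ pt i a $ pt l b = 0" "a div n \<noteq> b div n"
    | "A 3 $ pt i a $ pt l b = 0" "a div n = b div n"
    using A_01[of 3 "pt i a" "pt l b"] A_01[of 4 "pt i a" "pt l b"] A4 by fastforce
  then show ?thesis
    by cases (use eq A4 div in \<open>simp_all add: t\<close>)
qed

section \<open>Blocks between two fibres as dimension-indexed matrices\<close>

definition block :: "real^'x^'x \<Rightarrow> nat \<Rightarrow> nat \<Rightarrow> real mat" where
  "block Z i j = Matrix.mat (m * n) (m * n) (\<lambda>(a, b). Z $ pt i a $ pt j b)"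

lemma block_dim: "block Z i j \<in> carrier_mat (m * n) (m * n)"
  by (simp add: block_def)

lemma block_index: "a < m * n \<Longrightarrow> b < m * n \<Longrightarrow> block Z i j $$ (a, b) = Z $ pt i a $ pt j b"
  by (simp add: block_def)

lemma block_mult_index:
  assumes "a < m * n" "b < m * n"
  shows "(block Y i j * block Z j l) $$ (a, b)
    = (\<Sum>e<m * n. Y $ pt i a $ pt j e * Z $ pt j e $ pt l b)"
  using assms by (simp add: block_def scalar_prod_def atLeast0LessThan)

lemma transpose_block:
  assumes "\<And>x y. Z $ x $ y = Z $ y $ x"
  shows "transpose_mat (block Z i j) = block Z j i"
  by (rule eq_matI) (auto simp: block_def assms)

lemma K_mat_dim: "K_mat m n \<in> carrier_mat (m * n) (m * n)"
  by (simp add: K_mat_def kronecker_def J_mat_def)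

lemma K_mat_index:
  assumes "a < m * n" "b < m * n"
  shows "K_mat m n $$ (a, b) = of_bool (a div n = b div n)"
proof -
  have "a div n < m" "b div n < m" using assms by (simp_all add: less_mult_imp_div_less)
  then show ?thesis using assms n by (simp add: K_mat_def kronecker_def J_mat_def)
qed

lemma J_mat_index: "a < t \<Longrightarrow> b < t \<Longrightarrow> J_mat t $$ (a, b) = 1"
  by (simp add: J_mat_def)

lemma J_mat_dim: "J_mat t \<in> carrier_mat t t"
  by (simp add: J_mat_def)

lemma zero_one_block:
  assumes "\<And>a b. a < m * n \<Longrightarrow> b < m * n \<Longrightarrow> Z $ pt i a $ pt j b \<in> {0, 1}"
  shows "zero_one_mat (block Z i j)"
  using assms by (fastforce simp: zero_one_mat_def elements_mat_def block_def)

text \<open>Transposing a block of a symmetric \<open>Z\<close> swaps the two fibres, so both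
  products in the design condition count paths from one fibre to the other and back. A general
  \<open>Z\<close> covers \<open>A 3\<close> as well as \<open>A 3 + A 5\<close>.\<close>

lemma gdd_block:
  assumes sym: "\<And>x y. Z $ x $ y = Z $ y $ x"
    and zo: "\<And>a b. a < m * n \<Longrightarrow> b < m * n \<Longrightarrow> Z $ pt i a $ pt j b \<in> {0, 1}"
    and paths: "\<And>i' j' a b. (i', j') \<in> {(i, j), (j, i)} \<Longrightarrow> a < m * n \<Longrightarrow> b < m * n \<Longrightarrow>
      (\<Sum>e<m * n. Z $ pt i' a $ pt j' e * Z $ pt j' e $ pt i' b)
        = (if a = b then real r else if a div n = b div n then l1 else l2)"
  shows "symmetric_gdd (block Z i j) (m * n) r m n l1 l2"
proof -
  define R where "R = real r \<cdot>\<^sub>m 1\<^sub>m (m * n) + l1 \<cdot>\<^sub>m (K_mat m n - 1\<^sub>m (m * n))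
    + l2 \<cdot>\<^sub>m (J_mat (m * n) - K_mat m n)"
  note dims = carrier_matD[OF K_mat_dim] carrier_matD[OF J_mat_dim[of "m * n"]]
  have R: "block Z i' j' * block Z j' i' = R" if "(i', j') \<in> {(i, j), (j, i)}" for i' j'
  proof (rule eq_matI)
    show "dim_row (block Z i' j' * block Z j' i') = dim_row R"
      "dim_col (block Z i' j' * block Z j' i') = dim_col R"
      using dims by (auto simp: R_def block_def)
    fix a b assume "a < dim_row R" "b < dim_col R"
    then have ab: "a < m * n" "b < m * n" using dims by (auto simp: R_def)
    then have "R $$ (a, b) = (if a = b then real r else if a div n = b div n then l1 else l2)"
      using dims by (simp add: R_def K_mat_index J_mat_index)
    then show "(block Z i' j' * block Z j' i') $$ (a, b) = R $$ (a, b)"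
      unfolding block_mult_index[OF ab] paths[OF that ab] by simp
  qed
  show ?thesis
    using R m n block_dim zero_one_block[OF zo]
    by (simp add: symmetric_gdd_def transpose_block[OF sym] Let_def R_def)
qed

section \<open>The designs and the linked system\<close>

lemma gdd_A3:
  assumes "i \<in> {1..f}" "j \<in> {1..f}" "i \<noteq> j"
  shows "symmetric_gdd (block (A 3) i j) (m * n) k m n
    (1 / (real f - 1) * real (p 3 3 1)) (1 / (real f - 1) * real (p 3 3 2))"
proof (rule gdd_block)
  fix i' j' a b assume "(i', j') \<in> {(i, j), (j, i)}" and ab: "a < m * n" "b < m * n"
  then have ij: "i' \<in> {1..f}" "j' \<in> {1..f}" "i' \<noteq> j'" using assms by auto
  show "(\<Sum>e<m * n. A 3 $ pt i' a $ pt j' e * A 3 $ pt j' e $ pt i' b)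
    = (if a = b then real k else if a div n = b div n then 1 / (real f - 1) * real (p 3 3 1)
       else 1 / (real f - 1) * real (p 3 3 2))"
    using paths_through_fibre[OF ij(1,2,1,3,3) ab] path_count_same_fibre[OF ij(1) ab] by simp
qed (use A_sym[of 3] A_01[of 3] in auto)

text \<open>Between different fibres \<open>A 5\<close> joins exactly the pairs in a common group,
  so its block is \<open>K_mat m n\<close>.\<close>

lemma block_add_K:
  assumes "i \<in> {1..f}" "j \<in> {1..f}" "i \<noteq> j"
  shows "block (A 3) i j + K_mat m n = block (A 3 + A 5) i j"
  using K_mat_dim assms
  by (intro eq_matI) (auto simp: block_def K_mat_index A_different_fibre)

lemma A35_01: "(A 3 + A 5) $ x $ y \<in> {0, 1}"
  using class_cases[of x y] by auto

text \<open>The constants \<sigma>, \<tau>, \<rho> are \<open>p 3 3 3\<close>,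
  \<open>p 3 3 4\<close> and \<open>p 3 3 5\<close>, each divided by the number \<open>f - 2\<close>
  of intermediate fibres.\<close>

lemma linked:
  assumes "3 \<le> f"
  shows "linked_system_type_II f (block (A 3)) (m * n) k m n
    (1 / (real f - 1) * real (p 3 3 1)) (1 / (real f - 1) * real (p 3 3 2))"
proof -
  have "block (A 3) i j * block (A 3) j l
      = real (p 3 3 3 div (f - 2)) \<cdot>\<^sub>m block (A 3) i l
        + real (p 3 3 4 div (f - 2)) \<cdot>\<^sub>m (J_mat (m * n) - block (A 3) i l - K_mat m n)
        + real (p 3 3 5 div (f - 2)) \<cdot>\<^sub>m K_mat m n" (is "_ = ?R")
    if "i \<in> {1..f}" "j \<in> {1..f}" "l \<in> {1..f}" "i \<noteq> j" "j \<noteq> l" "i \<noteq> l" for i j l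
  proof (rule eq_matI)
    note dims = carrier_matD[OF K_mat_dim] carrier_matD[OF J_mat_dim[of "m * n"]]
      carrier_matD[OF block_dim[of "A 3" i l]]
    show "dim_row (block (A 3) i j * block (A 3) j l) = dim_row ?R"
      "dim_col (block (A 3) i j * block (A 3) j l) = dim_col ?R"
      using dims by (auto simp: block_def)
    fix a b assume "a < dim_row ?R" "b < dim_col ?R"
    then have ab: "a < m * n" "b < m * n" by (simp_all add: dims)
    have "(block (A 3) i j * block (A 3) j l) $$ (a, b) = path_count (pt i a) (pt l b)"
      unfolding block_mult_index[OF ab] using that ab by (intro paths_through_fibre) auto
    also have "\<dots> = ?R $$ (a, b)"
      using ab path_count_different_fibre[OF that ab]
      by (simp add: dims K_mat_index J_mat_index block_index)
    finally show "(block (A 3) i j * block (A 3) j l) $$ (a, b) = ?R $$ (a, b)" .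
  qed
  then show ?thesis
    unfolding linked_system_type_II_def
    using assms gdd_A3 zero_one_block[OF A35_01] by (auto simp: block_add_K)
qed

text \<open>\<open>A 3 + A 5\<close> vanishes inside each fibre. With only two fibres, every path of
  length two that returns to its fibre passes through the other one, so the products of blocks can
  be read off the square in the algebra.\<close>

lemma gdd_A35:
  assumes "f = 2"
  shows "\<exists>r l1 l2. symmetric_gdd (block (A 3) 1 2 + K_mat m n) (m * n) r m n l1 l2"
proof -
  \<comment> \<open>\<open>q l\<close> is the coefficient of \<open>A l\<close> in the square of
    \<open>A 3 + A 5\<close>; classes 0, 1 and 2 supply the three parameters.\<close>
  define q where "q l = p 3 3 l + p 3 5 l + p 5 3 l + p 5 5 l" for l
  define Z where "Z = A 3 + A 5"
  have ZZ: "Z ** Z = A 3 ** A 3 + A 3 ** A 5 + A 5 ** A 3 + A 5 ** A 5"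
    by (simp add: Z_def matrix_add_ldistrib matrix_add_rdistrib add_ac)
  have "symmetric_gdd (block Z 1 2) (m * n) (q 0) m n (real (q 1)) (real (q 2))"
  proof (rule gdd_block)
    show "Z $ x $ y = Z $ y $ x" for x y
      using A_sym[of 3 x y] A_sym[of 5 x y] by (simp add: Z_def)
    show "Z $ pt 1 a $ pt 2 b \<in> {0, 1}" for a b using A35_01 by (simp add: Z_def)
    fix i j a b assume ij: "(i, j) \<in> {(1 :: nat, 2 :: nat), (2, 1)}" and ab: "a < m * n" "b < m * n"
    then have i: "i \<in> {1..f}" and fs: "{1..f} = {i, j}" "i \<noteq> j" using assms by auto
    have "(Z ** Z) $ pt i a $ pt i b = (\<Sum>e<m * n. Z $ pt i a $ pt i e * Z $ pt i e $ pt i b)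
        + (\<Sum>e<m * n. Z $ pt i a $ pt j e * Z $ pt j e $ pt i b)"
      unfolding matrix_mul_component sum_points fs(1) using fs(2) by simp
    also have "(\<Sum>e<m * n. Z $ pt i a $ pt i e * Z $ pt i e $ pt i b) = 0"
      using ab i by (intro sum.neutral) (simp add: Z_def A_same_fibre)
    finally have "(\<Sum>e<m * n. Z $ pt i a $ pt j e * Z $ pt j e $ pt i b) = (Z ** Z) $ pt i a $ pt i b"
      by simp
    also have "\<dots> = (if a = b then real (q 0) else if a div n = b div n then real (q 1)
        else real (q 2))"
      by (simp add: ZZ A_mult_entry_expanded A_same_fibre[OF i ab] q_def del: One_nat_def)
    finally show "(\<Sum>e<m * n. Z $ pt i a $ pt j e * Z $ pt j e $ pt i b)
      = (if a = b then real (q 0) else if a div n = b div n then real (q 1) else real (q 2))" .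
  qed
  moreover have "block (A 3) 1 2 + K_mat m n = block Z 1 2"
    unfolding Z_def using assms by (intro block_add_K) auto
  ultimately show ?thesis by metis
qed

end

theorem theorem5p3:
  fixes f k m n :: nat
    and A E :: "nat \<Rightarrow> real^'x^'x"
    and p :: "nat \<Rightarrow> nat \<Rightarrow> nat \<Rightarrow> nat"
    and l1 l2 :: real
  assumes "2 \<le> f" and "1 < m" and "1 < n" and "k \<le> (m - 1) * n"
    and "symmetric_association_scheme 5 A"
    and "intersection_numbers 5 A p"
    and "primitive_idempotent_ordering 5 A E"
    and "first_eigenmatrix 5 A E (eigenmatrix_P (real f) (real k) (real m) (real n))"
    and "l1 = 1 / (real f - 1) * real (p 3 3 1)"
    and "l2 = 1 / (real f - 1) * real (p 3 3 2)"
    and "l1 < real k" and "k < (m - 1) * n"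
  shows "(f = 2 \<longrightarrow>
            (\<exists>B. symmetric_gdd B (m * n) k m n l1 l2 \<and>
                 (\<exists>k' l1' l2'. symmetric_gdd (B + K_mat m n) (m * n) k' m n l1' l2'))) \<and>
         (3 \<le> f \<longrightarrow>
            (\<exists>B. linked_system_type_II f B (m * n) k m n l1 l2))"
proof -
  \<comment> \<open>The parameter \<open>l1\<close> is a non-negative multiple of an intersection
    number and lies below \<open>k\<close>.\<close>
  have "0 < k"
  proof -
    have "0 \<le> l1" using assms(1,9) by simp
    then show ?thesis using assms(11) by simp
  qed
  then interpret five_class_scheme f k m n A E p
    using assms by unfold_locales
  obtain pt where pt: "labelled_scheme f k m n A E p pt"
  proof (rule coordinates[OF equiv_F equiv_G card_quotient_F card_quotient_G card_F_G])
    show "0 < n" using n by simp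
    fix pt :: "nat \<Rightarrow> nat \<Rightarrow> 'x"
    assume "\<And>i j a b. i \<in> {1..f} \<Longrightarrow> j \<in> {1..f} \<Longrightarrow> a < m * n \<Longrightarrow> b < m * n \<Longrightarrow>
        (pt i a, pt j b) \<in> matrix_rel F \<longleftrightarrow> i = j"
      "\<And>i j a b. i \<in> {1..f} \<Longrightarrow> j \<in> {1..f} \<Longrightarrow> a < m * n \<Longrightarrow> b < m * n \<Longrightarrow>
        (pt i a, pt j b) \<in> matrix_rel G \<longleftrightarrow> a div n = b div n"
      "bij_betw (\<lambda>(i, a). pt i a) ({1..f} \<times> {..<m * n}) UNIV"
    then have "labelled_scheme f k m n A E p pt" by unfold_locales
    then show thesis by (rule that)
  qed
  interpret labelled_scheme f k m n A E p pt by (rule pt)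
  have "\<exists>B. symmetric_gdd B (m * n) k m n l1 l2 \<and>
      (\<exists>k' l1' l2'. symmetric_gdd (B + K_mat m n) (m * n) k' m n l1' l2')" if "f = 2"
    using gdd_A3[of 1 2] gdd_A35[OF that] that assms(9,10) by auto
  moreover have "\<exists>B. linked_system_type_II f B (m * n) k m n l1 l2" if "3 \<le> f"
    using linked[OF that] assms(9,10) by blast
  ultimately show ?thesis by blast
qed

end
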